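(* Let $\sigma>0$ and $1\le r<s\le n$. Let $X_{1:n}<\dots<X_{n:n}$ be the order statistics of a sample of size $n$ from the density $\frac1\sigma f\left(\frac{x}{\sigma}\right)$, and let $\boldsymbol X=(X_{1:n},\dots,X_{r:n})^\top$. Then the marginal best linear invariant predictor $\tilde X_{s:n}$ of $X_{s:n}$ based on $\boldsymbol X$, i.e. the predictor of the form $\boldsymbol a^\top\boldsymbol X$, $\boldsymbol a\in\mathbb{R}^r$, that minimizes the mean squared predictive error $E[(\boldsymbol a^\top\boldsymbol X-X_{s:n})^2]$ over $\boldsymbol a\in\mathbb{R}^r$, is $\tilde X_{s:n}=\boldsymbol a^\top\boldsymbol X$ with $$\boldsymbol a=(\boldsymbol\Sigma+\boldsymbol\alpha\boldsymbol\alpha^\top)^{-1}(\boldsymbol\omega_s+\alpha_s\boldsymbol\alpha).$$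
   Context: $f$ is a probability density on $\mathbb{R}$, and the sample consists of $n$ i.i.d. random variables with density $\frac1\sigma f\left(\frac{x}{\sigma}\right)$ (scale family). Put $Z_{i:n}=X_{i:n}/\sigma$, $1\le i\le n$, assumed to have finite second moments. Notation: $\alpha_i=E[Z_{i:n}]$ for $1\le i\le n$; $\boldsymbol\alpha=(\alpha_1,\dots,\alpha_r)^\top$; $\boldsymbol\Sigma$ is the $r\times r$ covariance matrix of $(Z_{1:n},\dots,Z_{r:n})^\top$, assumed positive definite; $\boldsymbol\omega_s=(\mathrm{Cov}(Z_{1:n},Z_{s:n}),\dots,\mathrm{Cov}(Z_{r:n},Z_{s:n}))^\top\in\mathbb{R}^r$. *)

theory Defs
  imports "HOL-Probability.Probability" "Jordan_Normal_Form.Gauss_Jordan_Elimination"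
begin

text \<open>The order statistics are numbered from 1, as usual, whereas lists, vectors and matrices are
  indexed from 0; hence the shifts by one below.\<close>

definition order_stat :: "nat \<Rightarrow> (nat \<Rightarrow> 'a \<Rightarrow> real) \<Rightarrow> nat \<Rightarrow> 'a \<Rightarrow> real" where
  "order_stat n X i \<omega> = sort (map (\<lambda>j. X j \<omega>) [1..<Suc n]) ! (i - 1)"

definition iid_sample :: "'a measure \<Rightarrow> (real \<Rightarrow> real) \<Rightarrow> nat \<Rightarrow> (nat \<Rightarrow> 'a \<Rightarrow> real) \<Rightarrow> bool" where
  "iid_sample M g n X \<longleftrightarrow>
     prob_space.indep_vars M (\<lambda>_. borel) X {1..n} \<and>
     (\<forall>j\<in>{1..n}. distributed M lborel (X j) (\<lambda>x. ennreal (g x)))"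

definition covariance :: "'a measure \<Rightarrow> ('a \<Rightarrow> real) \<Rightarrow> ('a \<Rightarrow> real) \<Rightarrow> real" where
  "covariance M U V =
     (\<integral>\<omega>. (U \<omega> - integral\<^sup>L M U) * (V \<omega> - integral\<^sup>L M V) \<partial>M)"

definition mean_vec :: "'a measure \<Rightarrow> nat \<Rightarrow> (nat \<Rightarrow> 'a \<Rightarrow> real) \<Rightarrow> real Matrix.vec" where
  "mean_vec M r Z = Matrix.vec r (\<lambda>i. integral\<^sup>L M (Z (Suc i)))"

definition cov_mat :: "'a measure \<Rightarrow> nat \<Rightarrow> (nat \<Rightarrow> 'a \<Rightarrow> real) \<Rightarrow> real Matrix.mat" where
  "cov_mat M r Z = Matrix.mat r r (\<lambda>(i, j). covariance M (Z (Suc i)) (Z (Suc j)))"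

definition cov_vec :: "'a measure \<Rightarrow> nat \<Rightarrow> (nat \<Rightarrow> 'a \<Rightarrow> real) \<Rightarrow> nat \<Rightarrow> real Matrix.vec" where
  "cov_vec M r Z s = Matrix.vec r (\<lambda>i. covariance M (Z (Suc i)) (Z s))"

definition pos_def_mat :: "real Matrix.mat \<Rightarrow> bool" where
  "pos_def_mat A \<longleftrightarrow> square_mat A \<and> transpose_mat A = A \<and>
     (\<forall>v \<in> carrier_vec (dim_row A). v \<noteq> 0\<^sub>v (dim_row A) \<longrightarrow> v \<bullet> (A *\<^sub>v v) > 0)"

text \<open>The \<open>r \<times> 1\<close> matrix with column \<open>v\<close> times the \<open>1 \<times> r\<close> matrix with row \<open>w\<close>.\<close>

definition outer_prod :: "real Matrix.vec \<Rightarrow> real Matrix.vec \<Rightarrow> real Matrix.mat" where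
  "outer_prod v w = mat_of_cols (dim_vec v) [v] * mat_of_rows (dim_vec w) [w]"

definition linear_predictor ::
    "nat \<Rightarrow> (nat \<Rightarrow> 'a \<Rightarrow> real) \<Rightarrow> real Matrix.vec \<Rightarrow> 'a \<Rightarrow> real" where
  "linear_predictor r Y a \<omega> = a \<bullet> Matrix.vec r (\<lambda>i. Y (Suc i) \<omega>)"

definition mspe :: "'a measure \<Rightarrow> ('a \<Rightarrow> real) \<Rightarrow> ('a \<Rightarrow> real) \<Rightarrow> real" where
  "mspe M P T = (\<integral>\<omega>. (P \<omega> - T \<omega>)\<^sup>2 \<partial>M)"

definition marginal_blip ::
    "'a measure \<Rightarrow> nat \<Rightarrow> (nat \<Rightarrow> 'a \<Rightarrow> real) \<Rightarrow> nat \<Rightarrow> ('a \<Rightarrow> real) \<Rightarrow> bool" where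
  "marginal_blip M r Y s P \<longleftrightarrow>
     is_arg_min (\<lambda>Q. mspe M Q (Y s)) (\<lambda>Q. \<exists>a\<in>carrier_vec r. Q = linear_predictor r Y a) P"

end

theory Submission
  imports Defs "Jordan_Normal_Form.Determinant"
begin

text \<open>Both \<open>\<Sigma> + \<alpha>\<alpha>\<^sup>T\<close> and \<open>\<omega>\<^sub>s + \<alpha>\<^sub>s\<alpha>\<close> collect uncentred second moments of the \<open>Z\<^sub>i\<close>, so up to
  the factor \<open>\<sigma>\<^sup>2\<close> the error of the predictor \<open>c\<^sup>TY\<close> is the quadratic \<open>c\<^sup>TGc - 2c\<^sup>Th + E[Z\<^sub>s\<^sup>2]\<close>
  with \<open>G = \<Sigma> + \<alpha>\<alpha>\<^sup>T\<close> positive definite and \<open>h = \<omega>\<^sub>s + \<alpha>\<^sub>s\<alpha>\<close>; completing the square at the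
  solution of \<open>Ga = h\<close> gives the unique minimizer.\<close>

section \<open>Measurability of order statistics\<close>

text \<open>In a sorted list the entries that are at most \<open>t\<close> form an initial segment,
  and the filtered list is exactly this segment.\<close>

lemma sorted_nth_le_iff:
  fixes xs :: "'b::linorder list"
  assumes "sorted xs" "k < length xs"
  shows "xs ! k \<le> t \<longleftrightarrow> k < length (filter (\<lambda>x. x \<le> t) xs)"
  using assms
proof (induction xs arbitrary: k)
  case (Cons x xs)
  show ?case
  proof (cases "x \<le> t")
    case True
    then show ?thesis using Cons by (cases k) auto
  next
    case False
    \<comment> \<open>The head is a least entry, so once it exceeds \<open>t\<close> all entries do:
      the filtered list is empty and both sides are false.\<close>
    with Cons.prems have "\<forall>y\<in>set (x # xs). \<not> y \<le> t" by auto
    then show ?thesis using Cons.prems(2) nth_mem[of k "x # xs"]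
      by (metis filter_False list.size(3) not_less_zero)
  qed
qed simp

text \<open>Sorting only permutes the list, which leaves the number of entries at most
  \<open>t\<close> unchanged.\<close>

lemma sort_nth_le_iff:
  fixes xs :: "'b::linorder list"
  assumes "k < length xs"
  shows "sort xs ! k \<le> t \<longleftrightarrow> k < length (filter (\<lambda>x. x \<le> t) xs)"
proof -
  have "length (filter (\<lambda>x. x \<le> t) (sort xs)) = length (filter (\<lambda>x. x \<le> t) xs)"
    by (metis length_sort filter_sort)
  then show ?thesis
    using sorted_nth_le_iff[of "sort xs" k t] assms by simp
qed

lemma borel_measurable_order_stat:
  assumes X: "\<And>j. j \<in> {1..n} \<Longrightarrow> X j \<in> borel_measurable M"
    and i: "i \<in> {1..n}"
  shows "order_stat n X i \<in> borel_measurable M"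
proof (subst borel_measurable_iff_le, rule allI)
  fix t
  \<comment> \<open>Position \<open>i - 1\<close> holds the \<open>i\<close>-th smallest value, so
    the condition says that at least \<open>i\<close> sample values are at most \<open>t\<close>. As
    a finite real sum of indicators the count is visibly measurable.\<close>
  have *: "order_stat n X i \<omega> \<le> t \<longleftrightarrow> real (i - 1) < (\<Sum>j\<in>{1..n}. if X j \<omega> \<le> t then 1 else 0)"
    for \<omega>
  proof -
    \<comment> \<open>Indices are counted rather than values: they are distinct, so ties among the
      \<open>X j\<close> do no harm.\<close>
    have "length (filter (\<lambda>x. x \<le> t) (map (\<lambda>j. X j \<omega>) [1..<Suc n]))
        = card (set (filter (\<lambda>j. X j \<omega> \<le> t) [1..<Suc n]))"
      by (subst distinct_card) (simp_all add: filter_map comp_def del: upt_Suc)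
    also have "set (filter (\<lambda>j. X j \<omega> \<le> t) [1..<Suc n]) = {j \<in> {1..n}. X j \<omega> \<le> t}"
      by auto
    also have "real (card \<dots>) = (\<Sum>j\<in>{1..n}. if X j \<omega> \<le> t then 1 else 0)"
      by (simp add: sum.If_cases Int_def del: One_nat_def)
    finally show ?thesis
      unfolding order_stat_def using i
      by (subst sort_nth_le_iff) (auto simp del: upt_Suc sum.If_cases)
  qed
  have [measurable]: "X j \<in> borel_measurable M" if "j \<in> {1..n}" for j
    using X that .
  show "{\<omega> \<in> space M. order_stat n X i \<omega> \<le> t} \<in> sets M"
    unfolding * by measurable
qed

section \<open>Second moments\<close>

text \<open>The product is dominated by the sum of the squares, a weak form of the inequality
  between arithmetic and geometric mean.\<close>

lemma integrable_mult_of_squares: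
  fixes U V :: "'a \<Rightarrow> real"
  assumes [measurable]: "U \<in> borel_measurable M" "V \<in> borel_measurable M"
    and "integrable M (\<lambda>\<omega>. (U \<omega>)\<^sup>2)" "integrable M (\<lambda>\<omega>. (V \<omega>)\<^sup>2)"
  shows "integrable M (\<lambda>\<omega>. U \<omega> * V \<omega>)"
proof (rule Bochner_Integration.integrable_bound)
  show "integrable M (\<lambda>\<omega>. (U \<omega>)\<^sup>2 + (V \<omega>)\<^sup>2)" using assms by simp
  have "\<bar>u * v\<bar> \<le> u\<^sup>2 + v\<^sup>2" for u v :: real
  proof -
    have "0 \<le> (\<bar>u\<bar> - \<bar>v\<bar>)\<^sup>2" by simp
    then have "2 * \<bar>u * v\<bar> \<le> u\<^sup>2 + v\<^sup>2"
      by (simp add: power2_diff abs_mult)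
    then show ?thesis by linarith
  qed
  then show "AE \<omega> in M. norm (U \<omega> * V \<omega>) \<le> norm ((U \<omega>)\<^sup>2 + (V \<omega>)\<^sup>2)" by simp
qed simp

text \<open>The constant 1 is square integrable for a probability measure, so it can serve as the
  second factor of a product.\<close>

lemma (in prob_space) integrable_of_square:
  fixes U :: "'a \<Rightarrow> real"
  assumes "U \<in> borel_measurable M" "integrable M (\<lambda>\<omega>. (U \<omega>)\<^sup>2)"
  shows "integrable M U"
  using integrable_mult_of_squares[of U M "\<lambda>_. 1"] assms by simp

lemma (in prob_space) covariance_add_mean_mult:
  assumes "U \<in> borel_measurable M" "V \<in> borel_measurable M"
    and "integrable M (\<lambda>\<omega>. (U \<omega>)\<^sup>2)" "integrable M (\<lambda>\<omega>. (V \<omega>)\<^sup>2)"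
  shows "covariance M U V + integral\<^sup>L M U * integral\<^sup>L M V = (\<integral>\<omega>. U \<omega> * V \<omega> \<partial>M)"
proof -
  note [simp] = integrable_of_square[OF assms(1,3)] integrable_of_square[OF assms(2,4)]
    integrable_mult_of_squares[OF assms]
  \<comment> \<open>After expansion the integral splits by linearity; total mass 1 evaluates the
    constant term, and three mean products collapse to one.\<close>
  have "covariance M U V =
      (\<integral>\<omega>. U \<omega> * V \<omega> - expectation V * U \<omega> - expectation U * V \<omega> + expectation U * expectation V \<partial>M)"
    unfolding covariance_def by (simp add: algebra_simps)
  then show ?thesis by (simp add: prob_space)
qed

section \<open>Uncentred moment matrices and vectors\<close>

lemma outer_prod_index:
  assumes "i < dim_vec v" "j < dim_vec w"
  shows "outer_prod v w $$ (i, j) = vec_index v i * vec_index w j"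
  using assms by (simp add: outer_prod_def scalar_prod_def mat_of_cols_def mat_of_rows_def)

lemma outer_prod_carrier: "outer_prod v w \<in> carrier_mat (dim_vec v) (dim_vec w)"
  unfolding outer_prod_def by (rule mult_carrier_mat[of _ _ 1])
    (simp_all add: mat_of_cols_def mat_of_rows_def)

text \<open>For square integrable \<open>Z\<close> this is the Gram matrix of the first
  \<open>r\<close> variables under the inner product E[UV].\<close>

definition moment_mat :: "'a measure \<Rightarrow> nat \<Rightarrow> (nat \<Rightarrow> 'a \<Rightarrow> real) \<Rightarrow> real Matrix.mat" where
  "moment_mat M r Z = Matrix.mat r r (\<lambda>(i, j). \<integral>\<omega>. Z (Suc i) \<omega> * Z (Suc j) \<omega> \<partial>M)"

text \<open>The right-hand side of the normal equations for predicting \<open>Z s\<close>.\<close>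

definition moment_vec :: "'a measure \<Rightarrow> nat \<Rightarrow> (nat \<Rightarrow> 'a \<Rightarrow> real) \<Rightarrow> nat \<Rightarrow> real Matrix.vec" where
  "moment_vec M r Z s = Matrix.vec r (\<lambda>i. \<integral>\<omega>. Z (Suc i) \<omega> * Z s \<omega> \<partial>M)"

lemma moment_mat_carrier: "moment_mat M r Z \<in> carrier_mat r r"
  by (simp add: moment_mat_def)

lemma moment_vec_carrier: "moment_vec M r Z s \<in> carrier_vec r"
  by (simp add: moment_vec_def)

lemma transpose_moment_mat: "transpose_mat (moment_mat M r Z) = moment_mat M r Z"
  by (rule eq_matI) (simp_all add: moment_mat_def mult.commute)

lemma (in prob_space) cov_mat_add_outer_prod:
  assumes "\<And>i. i \<in> {1..r} \<Longrightarrow> Z i \<in> borel_measurable M"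
    and "\<And>i. i \<in> {1..r} \<Longrightarrow> integrable M (\<lambda>\<omega>. (Z i \<omega>)\<^sup>2)"
  shows "cov_mat M r Z + outer_prod (mean_vec M r Z) (mean_vec M r Z) = moment_mat M r Z"
proof (rule eq_matI)
  fix i j assume "i < dim_row (moment_mat M r Z)" "j < dim_col (moment_mat M r Z)"
  then show "(cov_mat M r Z + outer_prod (mean_vec M r Z) (mean_vec M r Z)) $$ (i, j)
      = moment_mat M r Z $$ (i, j)"
    using outer_prod_carrier[of "mean_vec M r Z" "mean_vec M r Z"]
    by (simp add: cov_mat_def moment_mat_def outer_prod_index mean_vec_def
        covariance_add_mean_mult assms)
qed (use outer_prod_carrier[of "mean_vec M r Z" "mean_vec M r Z"] in
      \<open>simp_all add: moment_mat_def mean_vec_def\<close>)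

lemma (in prob_space) cov_vec_add_mean_vec:
  assumes "\<And>i. i \<in> {1..r} \<Longrightarrow> Z i \<in> borel_measurable M"
    and "\<And>i. i \<in> {1..r} \<Longrightarrow> integrable M (\<lambda>\<omega>. (Z i \<omega>)\<^sup>2)"
    and "Z s \<in> borel_measurable M" "integrable M (\<lambda>\<omega>. (Z s \<omega>)\<^sup>2)"
  shows "cov_vec M r Z s + integral\<^sup>L M (Z s) \<cdot>\<^sub>v mean_vec M r Z = moment_vec M r Z s"
  by (rule eq_vecI) (simp_all add: cov_vec_def mean_vec_def moment_vec_def assms
      flip: covariance_add_mean_mult)

section \<open>The prediction error as a quadratic in the coefficients\<close>

lemma mspe_linear_predictor:
  assumes meas: "\<And>i. i \<in> {1..r} \<Longrightarrow> Z i \<in> borel_measurable M"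
    and sq: "\<And>i. i \<in> {1..r} \<Longrightarrow> integrable M (\<lambda>\<omega>. (Z i \<omega>)\<^sup>2)"
    and T: "Z s \<in> borel_measurable M" "integrable M (\<lambda>\<omega>. (Z s \<omega>)\<^sup>2)"
    and c: "c \<in> carrier_vec r"
  shows "mspe M (linear_predictor r Z c) (Z s) =
    c \<bullet> (moment_mat M r Z *\<^sub>v c) - 2 * (c \<bullet> moment_vec M r Z s) + (\<integral>\<omega>. (Z s \<omega>)\<^sup>2 \<partial>M)"
proof -
  have [simp]: "integrable M (\<lambda>\<omega>. Z (Suc i) \<omega> * Z (Suc j) \<omega>)" if "i < r" "j < r" for i j
    using that by (intro integrable_mult_of_squares meas sq) auto
  have [simp]: "integrable M (\<lambda>\<omega>. Z (Suc i) \<omega> * Z s \<omega>)" if "i < r" for i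
    using that by (intro integrable_mult_of_squares meas sq T) auto
  have "mspe M (linear_predictor r Z c) (Z s) =
    (\<integral>\<omega>. (\<Sum>i<r. \<Sum>j<r. vec_index c i * vec_index c j * (Z (Suc i) \<omega> * Z (Suc j) \<omega>))
        - 2 * (\<Sum>i<r. vec_index c i * (Z (Suc i) \<omega> * Z s \<omega>)) + (Z s \<omega>)\<^sup>2 \<partial>M)"
    unfolding mspe_def
  proof (rule Bochner_Integration.integral_cong[OF refl])
    fix \<omega>
    define S where "S = (\<Sum>i<r. vec_index c i * Z (Suc i) \<omega>)"
    have "linear_predictor r Z c \<omega> = S"
      by (simp add: S_def linear_predictor_def scalar_prod_def lessThan_atLeast0)
    moreover have "S\<^sup>2 = (\<Sum>i<r. \<Sum>j<r. vec_index c i * vec_index c j * (Z (Suc i) \<omega> * Z (Suc j) \<omega>))"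
      unfolding S_def power2_eq_square sum_product by (simp add: ac_simps)
    moreover have "S * Z s \<omega> = (\<Sum>i<r. vec_index c i * (Z (Suc i) \<omega> * Z s \<omega>))"
      unfolding S_def sum_distrib_right by (simp add: ac_simps)
    ultimately show "(linear_predictor r Z c \<omega> - Z s \<omega>)\<^sup>2 =
        (\<Sum>i<r. \<Sum>j<r. vec_index c i * vec_index c j * (Z (Suc i) \<omega> * Z (Suc j) \<omega>))
        - 2 * (\<Sum>i<r. vec_index c i * (Z (Suc i) \<omega> * Z s \<omega>)) + (Z s \<omega>)\<^sup>2"
      by (simp add: power2_diff)
  qed
  also have "\<dots> = (\<Sum>i<r. \<Sum>j<r. vec_index c i * vec_index c j * (\<integral>\<omega>. Z (Suc i) \<omega> * Z (Suc j) \<omega> \<partial>M))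
        - 2 * (\<Sum>i<r. vec_index c i * (\<integral>\<omega>. Z (Suc i) \<omega> * Z s \<omega> \<partial>M)) + (\<integral>\<omega>. (Z s \<omega>)\<^sup>2 \<partial>M)"
  proof -
    \<comment> \<open>Splitting the integral requires integrability of every piece. The generic
      \<open>d\<close> is later instantiated with the products of the entries of
      \<open>c\<close>.\<close>
    have 1: "integrable M (\<lambda>\<omega>. \<Sum>j<r. d i j * (Z (Suc i) \<omega> * Z (Suc j) \<omega>))"
      if "i < r" for d :: "nat \<Rightarrow> nat \<Rightarrow> real" and i
      using that by (intro Bochner_Integration.integrable_sum integrable_mult_right) simp
    have 2: "integrable M (\<lambda>\<omega>. \<Sum>i<r. \<Sum>j<r. d i j * (Z (Suc i) \<omega> * Z (Suc j) \<omega>))"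
      for d :: "nat \<Rightarrow> nat \<Rightarrow> real"
      using 1 by (intro Bochner_Integration.integrable_sum) simp
    have 3: "integrable M (\<lambda>\<omega>. 2 * (\<Sum>i<r. vec_index c i * (Z (Suc i) \<omega> * Z s \<omega>)))"
      by (intro Bochner_Integration.integrable_sum integrable_mult_right) simp
    have 4: "(\<integral>\<omega>. (\<Sum>i<r. \<Sum>j<r. d i j * (Z (Suc i) \<omega> * Z (Suc j) \<omega>)) \<partial>M) =
        (\<Sum>i<r. \<Sum>j<r. d i j * (\<integral>\<omega>. Z (Suc i) \<omega> * Z (Suc j) \<omega> \<partial>M))"
      for d :: "nat \<Rightarrow> nat \<Rightarrow> real"
      by (subst Bochner_Integration.integral_sum) (auto intro!: sum.cong 1)
    show ?thesis
      unfolding Bochner_Integration.integral_diff[OF 2 3] 4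
        Bochner_Integration.integral_add[OF Bochner_Integration.integrable_diff[OF 2 3] T(2)]
      by simp
  qed
  also have "(\<Sum>i<r. \<Sum>j<r. vec_index c i * vec_index c j * (\<integral>\<omega>. Z (Suc i) \<omega> * Z (Suc j) \<omega> \<partial>M))
      = c \<bullet> (moment_mat M r Z *\<^sub>v c)"
    using c by (simp add: scalar_prod_def moment_mat_def lessThan_atLeast0 sum_distrib_left ac_simps)
  also have "(\<Sum>i<r. vec_index c i * (\<integral>\<omega>. Z (Suc i) \<omega> * Z s \<omega> \<partial>M)) = c \<bullet> moment_vec M r Z s"
    by (simp add: scalar_prod_def moment_vec_def lessThan_atLeast0)
  finally show ?thesis .
qed

section \<open>Positive definite matrices\<close>

text \<open>The rank-one summand contributes the square of the scalar product of \<open>u\<close>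
  and \<open>v\<close>, so strict positivity is inherited from \<open>A\<close>.\<close>

lemma pos_def_mat_add_outer_prod:
  assumes "pos_def_mat A" "A \<in> carrier_mat r r" "u \<in> carrier_vec r"
    and v: "v \<in> carrier_vec r" "v \<noteq> 0\<^sub>v r"
  shows "v \<bullet> ((A + outer_prod u u) *\<^sub>v v) > 0"
proof -
  have O: "outer_prod u u \<in> carrier_mat r r"
    using outer_prod_carrier[of u u] assms(3) by simp
  have "v \<bullet> (outer_prod u u *\<^sub>v v) = (\<Sum>i<r. \<Sum>j<r. vec_index v i * (vec_index u i * vec_index u j * vec_index v j))"
    using O assms(3) v
    by (simp add: scalar_prod_def outer_prod_index lessThan_atLeast0 sum_distrib_left)
  also have "\<dots> = (\<Sum>i<r. vec_index u i * vec_index v i)\<^sup>2"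
    unfolding power2_eq_square sum_product by (simp add: ac_simps)
  finally have "v \<bullet> (outer_prod u u *\<^sub>v v) \<ge> 0" by simp
  moreover have "v \<bullet> (A *\<^sub>v v) > 0"
    using assms unfolding pos_def_mat_def by auto
  moreover have "v \<bullet> ((A + outer_prod u u) *\<^sub>v v) = v \<bullet> (A *\<^sub>v v) + v \<bullet> (outer_prod u u *\<^sub>v v)"
    using O assms(2) v
    by (simp add: add_mult_distrib_mat_vec[of _ r r] scalar_prod_add_distrib[of _ r])
  ultimately show ?thesis by linarith
qed

text \<open>A nonzero kernel vector would make the form vanish, so the determinant is
  nonzero.\<close>

lemma mat_inverse_of_pos_def:
  fixes G :: "real Matrix.mat"
  assumes G: "G \<in> carrier_mat r r"
    and pos: "\<And>v. v \<in> carrier_vec r \<Longrightarrow> v \<noteq> 0\<^sub>v r \<Longrightarrow> v \<bullet> (G *\<^sub>v v) > 0"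
  shows "invertible_mat G" "the (mat_inverse G) \<in> carrier_mat r r"
    "G * the (mat_inverse G) = 1\<^sub>m r"
proof -
  have "Determinant.det G \<noteq> 0"
  proof
    assume "Determinant.det G = 0"
    then obtain v where "v \<in> carrier_vec r" "v \<noteq> 0\<^sub>v r" "G *\<^sub>v v = 0\<^sub>v r"
      using det_0_iff_vec_prod_zero[OF G] by auto
    then show False using pos[of v] by simp
  qed
  then have "G \<in> Units (ring_mat TYPE(real) r ())"
    using det_non_zero_imp_unit[OF G] by simp
  \<comment> \<open>\<open>mat_inverse\<close> returns \<open>None\<close> only for non-units, so
    \<open>the\<close> is applied to a genuine inverse.\<close>
  then obtain B where B: "mat_inverse G = Some B"
    using mat_inverse(1)[OF G, of "()"] by (cases "mat_inverse G") auto
  note inv = mat_inverse(2)[OF G B]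
  then show "the (mat_inverse G) \<in> carrier_mat r r" "G * the (mat_inverse G) = 1\<^sub>m r"
    using B by auto
  show "invertible_mat G"
    unfolding invertible_mat_def inverts_mat_def using inv G by (auto intro!: exI[of _ B])
qed

section \<open>Minimizing a positive definite quadratic\<close>

lemma quadratic_complete_square:
  fixes G :: "real Matrix.mat"
  assumes G: "G \<in> carrier_mat r r" "transpose_mat G = G"
    and a: "a \<in> carrier_vec r" and c: "c \<in> carrier_vec r"
  shows "c \<bullet> (G *\<^sub>v c) - 2 * (c \<bullet> (G *\<^sub>v a)) =
    (a \<bullet> (G *\<^sub>v a) - 2 * (a \<bullet> (G *\<^sub>v a))) + (c - a) \<bullet> (G *\<^sub>v (c - a))"
proof -
  \<comment> \<open>Symmetry of \<open>G\<close> identifies the two cross terms in the expansion of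
    the form at \<open>c - a\<close>.\<close>
  have "a \<bullet> (G *\<^sub>v c) = c \<bullet> (G *\<^sub>v a)"
    using transpose_vec_mult_scalar[OF G(1) c a] G(1,2) a c by (simp add: comm_scalar_prod[of _ r])
  then show ?thesis
    using G(1) a c
    by (simp add: mult_minus_distrib_mat_vec[of _ r r] scalar_prod_minus_distrib[of _ r]
        minus_scalar_prod_distrib[of _ r])
qed

text \<open>The excess over the value at \<open>a\<close> is \<open>k\<close> times the form at
  \<open>c - a\<close>, which is positive unless \<open>c = a\<close>. Writing the linear term with
  \<open>G *\<^sub>v a\<close> builds the normal equations into the hypothesis.\<close>

lemma is_arg_min_quadratic:
  fixes G :: "real Matrix.mat" and k t :: real
  assumes G: "G \<in> carrier_mat r r" "transpose_mat G = G"
    and pos: "\<And>v. v \<in> carrier_vec r \<Longrightarrow> v \<noteq> 0\<^sub>v r \<Longrightarrow> v \<bullet> (G *\<^sub>v v) > 0"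
    and a: "a \<in> carrier_vec r"
    and k: "k > 0"
    and q: "\<And>c. c \<in> carrier_vec r \<Longrightarrow> q c = k * (c \<bullet> (G *\<^sub>v c) - 2 * (c \<bullet> (G *\<^sub>v a)) + t)"
  shows "is_arg_min q (\<lambda>c. c \<in> carrier_vec r) b \<longleftrightarrow> b = a"
proof -
  have less: "q a < q c" if c: "c \<in> carrier_vec r" "c \<noteq> a" for c
  proof -
    have "c - a \<noteq> 0\<^sub>v r"
    proof
      assume "c - a = 0\<^sub>v r"
      then have "vec_index c i = vec_index a i" if "i < r" for i
        using index_minus_vec(1)[of i a c] that a c by simp
      then show False using a c by (auto intro: eq_vecI)
    qed
    then have "(c - a) \<bullet> (G *\<^sub>v (c - a)) > 0" using pos[of "c - a"] a c by simp
    then show ?thesis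
      unfolding q[OF a] q[OF c(1)] using k quadratic_complete_square[OF G a c(1)] by simp
  qed
  \<comment> \<open>The strict inequality gives both directions: nothing beats \<open>a\<close>, and
    \<open>a\<close> beats every other candidate.\<close>
  show ?thesis
    unfolding is_arg_min_def using less a by (metis order.asym)
qed

text \<open>Linear predictors are homogeneous in the data. With \<open>k = \<sigma>\<close> this
  transfers the problem from \<open>Y\<close> to the standardized \<open>Z\<close>.\<close>

lemma mspe_scale:
  "mspe M (linear_predictor r (\<lambda>i \<omega>. k * Z i \<omega>) c) (\<lambda>\<omega>. k * T \<omega>) =
    k\<^sup>2 * mspe M (linear_predictor r Z c) T"
proof -
  have "linear_predictor r (\<lambda>i \<omega>. k * Z i \<omega>) c \<omega> = k * linear_predictor r Z c \<omega>" for \<omega>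
    by (simp add: linear_predictor_def scalar_prod_def sum_distrib_left ac_simps)
  then show ?thesis
    by (simp add: mspe_def power_mult_distrib flip: right_diff_distrib)
qed

theorem theorem4:
  fixes M :: "'a measure" and f :: "real \<Rightarrow> real" and \<sigma> :: real and n r s :: nat
    and X Y Z :: "nat \<Rightarrow> 'a \<Rightarrow> real" and a :: "real Matrix.vec"
  assumes "prob_space M"
    and "f \<in> borel_measurable borel" and "\<And>x. 0 \<le> f x" and "(\<integral>\<^sup>+ x. ennreal (f x) \<partial>lborel) = 1"
    and "\<sigma> > 0"
    and "1 \<le> r" and "r < s" and "s \<le> n"
    and "iid_sample M (\<lambda>x. 1 / \<sigma> * f (x / \<sigma>)) n X"
    and Y_def: "Y = order_stat n X"
    and Z_def: "Z = (\<lambda>i \<omega>. Y i \<omega> / \<sigma>)"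
    and "\<And>i. i \<in> {1..n} \<Longrightarrow> integrable M (\<lambda>\<omega>. (Z i \<omega>)\<^sup>2)"
    and "pos_def_mat (cov_mat M r Z)"
    and a_def: "a = the (mat_inverse (cov_mat M r Z + outer_prod (mean_vec M r Z) (mean_vec M r Z)))
                      *\<^sub>v (cov_vec M r Z s + integral\<^sup>L M (Z s) \<cdot>\<^sub>v mean_vec M r Z)"
  shows "invertible_mat (cov_mat M r Z + outer_prod (mean_vec M r Z) (mean_vec M r Z)) \<and>
    (\<forall>b. is_arg_min (\<lambda>c. mspe M (linear_predictor r Y c) (Y s)) (\<lambda>c. c \<in> carrier_vec r) b
           \<longleftrightarrow> b = a) \<and>
    (\<forall>P. marginal_blip M r Y s P \<longleftrightarrow> P = linear_predictor r Y a)"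
proof -
  interpret prob_space M by fact
  have "X j \<in> borel_measurable M" if "j \<in> {1..n}" for j
    using \<open>iid_sample M (\<lambda>x. 1 / \<sigma> * f (x / \<sigma>)) n X\<close> that
    by (auto simp: iid_sample_def indep_vars_def2)
  then have measn: "Z i \<in> borel_measurable M" if "i \<in> {1..n}" for i
    unfolding Z_def Y_def using that
    by (intro borel_measurable_divide borel_measurable_order_stat) auto
  \<comment> \<open>Since \<open>r < s\<close> and \<open>s \<le> n\<close>, the indices up to
    \<open>r\<close> lie in \<open>{1..n}\<close>.\<close>
  have meas: "Z i \<in> borel_measurable M" and sq: "integrable M (\<lambda>\<omega>. (Z i \<omega>)\<^sup>2)"
    if "i \<in> {1..r}" for i
    using that measn assms(7,8,12) by auto
  have T: "Z s \<in> borel_measurable M" "integrable M (\<lambda>\<omega>. (Z s \<omega>)\<^sup>2)"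
    using measn assms(6-8,12) by auto
  define G where "G = moment_mat M r Z"
  define h where "h = moment_vec M r Z s"
  have G_eq: "cov_mat M r Z + outer_prod (mean_vec M r Z) (mean_vec M r Z) = G"
    unfolding G_def by (rule cov_mat_add_outer_prod[OF meas sq])
  have h_eq: "cov_vec M r Z s + integral\<^sup>L M (Z s) \<cdot>\<^sub>v mean_vec M r Z = h"
    unfolding h_def by (rule cov_vec_add_mean_vec[of r Z s, OF meas sq T])
  have G: "G \<in> carrier_mat r r" "transpose_mat G = G" and h: "h \<in> carrier_vec r"
    by (simp_all add: G_def h_def moment_mat_carrier moment_vec_carrier transpose_moment_mat)
  have pos: "v \<bullet> (G *\<^sub>v v) > 0" if "v \<in> carrier_vec r" "v \<noteq> 0\<^sub>v r" for v
    unfolding G_eq[symmetric]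
    by (rule pos_def_mat_add_outer_prod[OF assms(13) _ _ that])
      (simp_all add: cov_mat_def mean_vec_def)
  note inv = mat_inverse_of_pos_def[OF G(1) pos]
  have a_eq: "a = the (mat_inverse G) *\<^sub>v h"
    unfolding a_def G_eq h_eq ..
  have a: "a \<in> carrier_vec r"
    unfolding a_eq using inv(2) h by simp
  \<comment> \<open>These are the normal equations.\<close>
  have Ga: "G *\<^sub>v a = h"
    unfolding a_eq using assoc_mult_mat_vec[OF G(1) inv(2) h] inv(3) h by simp
  have Y_eq: "Y = (\<lambda>i \<omega>. \<sigma> * Z i \<omega>)"
    unfolding Z_def using \<open>\<sigma> > 0\<close> by simp
  \<comment> \<open>The linear term \<open>c \<bullet> h\<close> is expressed through
    \<open>G *\<^sub>v a\<close>, the shape that \<open>is_arg_min_quadratic\<close>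
    expects.\<close>
  have q: "mspe M (linear_predictor r Y c) (Y s) =
      \<sigma>\<^sup>2 * (c \<bullet> (G *\<^sub>v c) - 2 * (c \<bullet> (G *\<^sub>v a)) + (\<integral>\<omega>. (Z s \<omega>)\<^sup>2 \<partial>M))"
    if "c \<in> carrier_vec r" for c
    unfolding Y_eq mspe_scale Ga unfolding G_def h_def
    by (subst mspe_linear_predictor[of r Z M s, OF meas sq T that]) simp_all
  have arg_min: "is_arg_min (\<lambda>c. mspe M (linear_predictor r Y c) (Y s)) (\<lambda>c. c \<in> carrier_vec r) b
      \<longleftrightarrow> b = a" for b
    by (rule is_arg_min_quadratic[OF G pos a _ q]) (use \<open>\<sigma> > 0\<close> in simp_all)
  have "marginal_blip M r Y s P \<longleftrightarrow> P = linear_predictor r Y a" for P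
  proof -
    \<comment> \<open>\<open>marginal_blip\<close> minimizes over predictors as functions, not over
      coefficients. The error depends only on the function, so a predictor is optimal exactly when
      some coefficient vector representing it is.\<close>
    have "marginal_blip M r Y s P \<longleftrightarrow> (\<exists>b. P = linear_predictor r Y b \<and>
        is_arg_min (\<lambda>c. mspe M (linear_predictor r Y c) (Y s)) (\<lambda>c. c \<in> carrier_vec r) b)"
      unfolding marginal_blip_def is_arg_min_def by blast
    then show ?thesis unfolding arg_min by blast
  qed
  then show ?thesis
    using inv(1) arg_min unfolding G_eq by blast
qed

end
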